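(* Let $Y$ and $Y'$ be nondegenerate Young graphs that are isomorphic as Young graphs via an isomorphism $\phi$. Then $\phi([[0,0]])=[[0,0]]$ and $\phi([0,0])=[0,0]$.
   Context: For integers $2\le k<g$, the labeled directed graph $H(g,k)$ has a distinguished starting node $[[0,0]]$ and other nodes labeled by pairs $[R,r]$ of integers with $0\le R,r\le k-1$ (the node $[0,0]$ is distinct from the starting node). For a node $[P,p]$ (the starting node treated as $[0,0]$ here) there is an edge labeled $(A,a)$ from $[P,p]$ to $[R,r]$ whenever $0\le A,a\le g-1$ are integers, $0\le R,r\le k-1$, $ka+p=A+rg$ and $kA+R=a+Pg$; edges leaving the starting node additionally require $A\ne0\ne a$; no edge enters the starting node. $H(g,k)$ consists of the starting node and all nodes reachable from it. An even pivot node is a node $[a,a]$; an odd pivot node is a node $[r,s]$ with an edge to $[s,r]$; the starting node is not a pivot node. The Young graph $Y(g,k)$ is obtained from $H(g,k)$ by deleting every node that is not a pivot node and from which no pivot node is reachable, with incident edges; a Young graph is any $Y(g,k)$, and it is nondegenerate if $H(g,k)$ contains a pivot node. Two Young graphs are isomorphic as Young graphs via $\phi$ if $\phi$ is a bijection of node sets that is an isomorphism of the underlying unlabeled directed graphs and $x$ is an even (resp. odd) pivot node iff $\phi(x)$ is. *)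

theory Defs
  imports "Graph_Theory.Graph_Theory"
begin

text \<open>\<open>Start\<close> is the starting node $[[0,0]]$ and \<open>Node R r\<close> is the node $[R,r]$.\<close>

datatype node = Start | Node int int

fun label :: "node \<Rightarrow> int \<times> int" where
  "label Start = (0, 0)"
| "label (Node R r) = (R, r)"

text \<open>An arc \<open>(u, (A, a), v)\<close> is an edge from \<open>u\<close> to \<open>v\<close> labeled \<open>(A, a)\<close>.\<close>

type_synonym arc = "node \<times> (int \<times> int) \<times> node"

definition young_arc :: "int \<Rightarrow> int \<Rightarrow> arc \<Rightarrow> bool" where
  "young_arc g k e \<longleftrightarrow> (case e of (u, (A, a), v) \<Rightarrow>
     (\<exists>P p R r. label u = (P, p) \<and> v = Node R r \<and>
        0 \<le> A \<and> A \<le> g - 1 \<and> 0 \<le> a \<and> a \<le> g - 1 \<and>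
        0 \<le> R \<and> R \<le> k - 1 \<and> 0 \<le> r \<and> r \<le> k - 1 \<and>
        k * a + p = A + r * g \<and> k * A + R = a + P * g \<and>
        (u = Start \<longrightarrow> A \<noteq> 0 \<and> a \<noteq> 0)))"

text \<open>The graph on all admissible nodes, before restricting to those reachable from \<open>Start\<close>.\<close>

definition full_graph :: "int \<Rightarrow> int \<Rightarrow> (node, arc) pre_digraph" where
  "full_graph g k =
     (let V = insert Start {Node R r | R r. 0 \<le> R \<and> R \<le> k - 1 \<and> 0 \<le> r \<and> r \<le> k - 1}
      in \<lparr> verts = V,
           arcs = {(u, l, v). u \<in> V \<and> young_arc g k (u, l, v)},
           tail = (\<lambda>(u, l, v). u),
           head = (\<lambda>(u, l, v). v) \<rparr>)"

definition H_graph :: "int \<Rightarrow> int \<Rightarrow> (node, arc) pre_digraph" where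
  "H_graph g k = full_graph g k \<restriction> {v. Start \<rightarrow>\<^sup>*\<^bsub>full_graph g k\<^esub> v}"

definition even_pivot :: "(node, arc) pre_digraph \<Rightarrow> node \<Rightarrow> bool" where
  "even_pivot G v \<longleftrightarrow> v \<in> verts G \<and> (\<exists>a. v = Node a a)"

definition odd_pivot :: "(node, arc) pre_digraph \<Rightarrow> node \<Rightarrow> bool" where
  "odd_pivot G v \<longleftrightarrow> v \<in> verts G \<and> (\<exists>r s. v = Node r s \<and> Node r s \<rightarrow>\<^bsub>G\<^esub> Node s r)"

definition pivot :: "(node, arc) pre_digraph \<Rightarrow> node \<Rightarrow> bool" where
  "pivot G v \<longleftrightarrow> even_pivot G v \<or> odd_pivot G v"

definition Young_graph :: "int \<Rightarrow> int \<Rightarrow> (node, arc) pre_digraph" where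
  "Young_graph g k = H_graph g k \<restriction>
     (verts (H_graph g k) -
        {v. \<not> pivot (H_graph g k) v \<and> \<not> (\<exists>w. pivot (H_graph g k) w \<and> v \<rightarrow>\<^sup>*\<^bsub>H_graph g k\<^esub> w)})"

definition nondegenerate :: "int \<Rightarrow> int \<Rightarrow> bool" where
  "nondegenerate g k \<longleftrightarrow> (\<exists>v. pivot (H_graph g k) v)"

text \<open>
  \<open>\<phi>\<close> is the node part of an isomorphism of directed graphs.  The arcs are mapped by an arbitrary
  bijection respecting tails and heads, so their labels are disregarded.  Pivot nodes are those of
  the ambient graphs \<open>H_graph\<close>.
\<close>

definition Young_isomorphism :: "int \<Rightarrow> int \<Rightarrow> int \<Rightarrow> int \<Rightarrow> (node \<Rightarrow> node) \<Rightarrow> bool" where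
  "Young_isomorphism g k g' k' \<phi> \<longleftrightarrow>
     (\<exists>hom. pre_digraph.digraph_isomorphism (Young_graph g k) hom \<and>
            Young_graph g' k' = app_iso hom (Young_graph g k) \<and> \<phi> = iso_verts hom) \<and>
     (\<forall>x \<in> verts (Young_graph g k).
        (even_pivot (H_graph g k) x \<longleftrightarrow> even_pivot (H_graph g' k') (\<phi> x)) \<and>
        (odd_pivot (H_graph g k) x \<longleftrightarrow> odd_pivot (H_graph g' k') (\<phi> x)))"

lemma wf_full_graph: "wf_digraph (full_graph g k)"
  by unfold_locales (auto simp: full_graph_def Let_def young_arc_def)

lemma wf_H_graph: "wf_digraph (H_graph g k)"
  unfolding H_graph_def
  by unfold_locales (auto simp: induce_subgraph_def)

lemma wf_Young_graph: "wf_digraph (Young_graph g k)"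
  unfolding Young_graph_def
  by unfold_locales (auto simp: induce_subgraph_def)

text \<open>There are no parallel edges, so a graph isomorphism is just a bijection of the nodes
  preserving and reflecting adjacency.\<close>

lemma young_arc_unique:
  assumes "2 \<le> k" "young_arc g k (u, l, v)" "young_arc g k (u, l', v)"
  shows "l = l'"
proof -
  obtain A a A' a' where l: "l = (A, a)" "l' = (A', a')" by (metis surj_pair)
  have 1: "A' - A = k * (a' - a)" and 2: "a' - a = k * (A' - A)"
    using assms(2,3) by (auto simp: l young_arc_def algebra_simps)
  have "(k * k - 1) * (A' - A) = 0" 
    using 1 2 by (simp add: algebra_simps)
  moreover have "k * k > 1" using assms(1) by (simp add: less_1_mult)
  ultimately have "A' = A" by simp
  with 2 show ?thesis by (simp add: l)
qed

lemma Young_graph_arcs: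
  "arcs (Young_graph g k) \<subseteq> {e. young_arc g k e}"
  "tail (Young_graph g k) = fst" "head (Young_graph g k) = snd \<circ> snd"
  by (auto simp: Young_graph_def H_graph_def induce_subgraph_def full_graph_def Let_def fun_eq_iff)

lemma inj_on_arc_to_ends:
  assumes "2 \<le> k"
  shows "inj_on (arc_to_ends (Young_graph g k)) (arcs (Young_graph g k))"
  using young_arc_unique[OF assms] Young_graph_arcs(1)[of g k]
  by (fastforce simp: inj_on_def arc_to_ends_def Young_graph_arcs(2,3))

lemma digraph_isomorphism_iff_adjacency:
  assumes "2 \<le> k" "2 \<le> k'"
  shows "(\<exists>hom. pre_digraph.digraph_isomorphism (Young_graph g k) hom \<and>
            Young_graph g' k' = app_iso hom (Young_graph g k) \<and> \<phi> = iso_verts hom) \<longleftrightarrow>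
         bij_betw \<phi> (verts (Young_graph g k)) (verts (Young_graph g' k')) \<and>
         (\<forall>u \<in> verts (Young_graph g k). \<forall>v \<in> verts (Young_graph g k).
            u \<rightarrow>\<^bsub>Young_graph g k\<^esub> v \<longleftrightarrow> \<phi> u \<rightarrow>\<^bsub>Young_graph g' k'\<^esub> \<phi> v)"
    (is "?L \<longleftrightarrow> ?R")
proof
  let ?Y = "Young_graph g k" and ?Y' = "Young_graph g' k'"
  interpret Y: wf_digraph ?Y by (rule wf_Young_graph)
  assume ?L
  then obtain hom where hom: "Y.digraph_isomorphism hom" and Y': "?Y' = app_iso hom ?Y"
    and \<phi>: "\<phi> = iso_verts hom" by blast
  have inj: "inj_on \<phi> (verts ?Y)" using hom by (simp add: Y.digraph_isomorphism_def \<phi>)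
  have ends: "arcs_ends ?Y' = map_prod \<phi> \<phi> ` arcs_ends ?Y"
    using hom unfolding Y' \<phi> arcs_ends_def arc_to_ends_def app_iso_simps image_image
    by (intro image_cong) (auto simp: Y.digraph_isomorphism_def)
  have "u \<rightarrow>\<^bsub>?Y\<^esub> v \<longleftrightarrow> \<phi> u \<rightarrow>\<^bsub>?Y'\<^esub> \<phi> v" if "u \<in> verts ?Y" "v \<in> verts ?Y" for u v
  proof
    assume "\<phi> u \<rightarrow>\<^bsub>?Y'\<^esub> \<phi> v"
    then obtain x y where xy: "x \<rightarrow>\<^bsub>?Y\<^esub> y" "\<phi> u = \<phi> x" "\<phi> v = \<phi> y"
      by (auto simp: ends)
    then have "x = u" "y = v"
      using inj_onD[OF inj] that Y.adj_in_verts by metis+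
    with xy show "u \<rightarrow>\<^bsub>?Y\<^esub> v" by simp
  qed (force simp: ends)
  then show ?R using inj by (auto simp: bij_betw_def Y' \<phi>)
next
  let ?Y = "Young_graph g k" and ?Y' = "Young_graph g' k'"
  interpret Y: wf_digraph ?Y by (rule wf_Young_graph)
  interpret Y': wf_digraph ?Y' by (rule wf_Young_graph)
  assume R: ?R
  have inj: "inj_on \<phi> (verts ?Y)" and im: "\<phi> ` verts ?Y = verts ?Y'"
    using R by (auto simp: bij_betw_def)
  have ends: "arcs_ends ?Y' = map_prod \<phi> \<phi> ` arcs_ends ?Y"
  proof (intro set_eqI iffI)
    fix e assume e: "e \<in> arcs_ends ?Y'"
    obtain x y where xy: "e = (x, y)" by (cases e)
    with e have "x \<in> verts ?Y'" "y \<in> verts ?Y'" using Y'.adj_in_verts by auto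
    with im obtain u v where "u \<in> verts ?Y" "v \<in> verts ?Y" "x = \<phi> u" "y = \<phi> v"
      by (metis imageE)
    with R e xy show "e \<in> map_prod \<phi> \<phi> ` arcs_ends ?Y" by force
  next
    fix e assume "e \<in> map_prod \<phi> \<phi> ` arcs_ends ?Y"
    then obtain u v where "u \<rightarrow>\<^bsub>?Y\<^esub> v" "e = (\<phi> u, \<phi> v)" by auto
    with R Y.adj_in_verts show "e \<in> arcs_ends ?Y'" by blast
  qed
  define f where "f e = the_inv_into (arcs ?Y') (arc_to_ends ?Y')
     (map_prod \<phi> \<phi> (arc_to_ends ?Y e))" for e
  have inj_map: "inj_on (map_prod \<phi> \<phi>) (arcs_ends ?Y)"
    using inj Y.adj_in_verts by (fastforce simp: inj_on_def)
  have b1: "bij_betw (arc_to_ends ?Y) (arcs ?Y) (arcs_ends ?Y)"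
    using inj_on_arc_to_ends[OF assms(1)] by (simp add: bij_betw_def arcs_ends_def)
  have b2: "bij_betw (map_prod \<phi> \<phi>) (arcs_ends ?Y) (arcs_ends ?Y')"
    using inj_map by (simp add: bij_betw_def ends)
  have b3': "bij_betw (arc_to_ends ?Y') (arcs ?Y') (arcs_ends ?Y')"
    using inj_on_arc_to_ends[OF assms(2)] by (simp add: bij_betw_def arcs_ends_def)
  note b3 = bij_betw_the_inv_into[OF b3']
  have f_eq: "f = the_inv_into (arcs ?Y') (arc_to_ends ?Y') \<circ> (map_prod \<phi> \<phi> \<circ> arc_to_ends ?Y)"
    by (simp add: fun_eq_iff f_def)
  have bf: "bij_betw f (arcs ?Y) (arcs ?Y')"
    unfolding f_eq by (rule bij_betw_trans[OF bij_betw_trans[OF b1 b2] b3])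
  have fe: "arc_to_ends ?Y' (f e) = map_prod \<phi> \<phi> (arc_to_ends ?Y e)" if "e \<in> arcs ?Y" for e
  proof -
    have "arc_to_ends ?Y e \<in> arcs_ends ?Y" using that by (simp add: arcs_ends_def)
    then have "map_prod \<phi> \<phi> (arc_to_ends ?Y e) \<in> arcs_ends ?Y'" unfolding ends by (rule imageI)
    then show ?thesis unfolding f_def by (rule f_the_inv_into_f_bij_betw[OF b3'])
  qed
  let ?hom = "\<lparr> iso_verts = \<phi>, iso_arcs = f, iso_head = head ?Y', iso_tail = tail ?Y' \<rparr>"
  have "Y.digraph_isomorphism ?hom"
    using inj bf fe Y.wf_digraph_axioms
    by (auto simp: Y.digraph_isomorphism_def bij_betw_def arc_to_ends_def)
  moreover have "?Y' = app_iso ?hom ?Y"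
    using im bf by (simp add: app_iso_def bij_betw_def)
  ultimately show ?L by (intro exI[of _ ?hom]) simp
qed

end

theory Submission
  imports Defs
begin

text \<open>
  The starting node is the only node of a Young graph without a predecessor, so \<open>\<phi>\<close> fixes it.
  The image of \<open>[0,0]\<close> is an even pivot \<open>[c,c]\<close> with a loop, and it shares a successor with the
  starting node, because \<open>[0,0]\<close> does.  Subtracting the labels of these two edges shows that
  \<open>k\<^sup>2 - 1\<close> divides \<open>c (g - k)\<close>; subtracting this difference from the label of the loop
  gives a label for an edge from the starting node to \<open>[c,c]\<close>, which is admissible if \<open>c > 0\<close>.
  But there is no edge from the starting node to \<open>[0,0]\<close>.
\<close>

section \<open>Nodes and edges of \<open>H_graph\<close> and \<open>Young_graph\<close>\<close>

lemma verts_full_graph: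
  "verts (full_graph g k) = insert Start {Node R r | R r. 0 \<le> R \<and> R \<le> k - 1 \<and> 0 \<le> r \<and> r \<le> k - 1}"
  by (simp add: full_graph_def Let_def)

lemma adj_full_graph:
  "u \<rightarrow>\<^bsub>full_graph g k\<^esub> v \<longleftrightarrow> u \<in> verts (full_graph g k) \<and> (\<exists>l. young_arc g k (u, l, v))"
  by (force simp: arcs_ends_def arc_to_ends_def full_graph_def Let_def image_iff)

lemma adj_induce_subgraph:
  "u \<rightarrow>\<^bsub>G \<restriction> S\<^esub> v \<longleftrightarrow> u \<rightarrow>\<^bsub>G\<^esub> v \<and> u \<in> S \<and> v \<in> S"
  by (auto simp: arcs_ends_def arc_to_ends_def induce_subgraph_def image_iff)

lemma verts_H_graph: "v \<in> verts (H_graph g k) \<longleftrightarrow> Start \<rightarrow>\<^sup>*\<^bsub>full_graph g k\<^esub> v"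
  by (simp add: H_graph_def)

text \<open>The head of an edge leaving a reachable node is itself reachable, so only the tail needs
  checking.\<close>

lemma adj_H_graph:
  "u \<rightarrow>\<^bsub>H_graph g k\<^esub> v \<longleftrightarrow> u \<in> verts (H_graph g k) \<and> u \<rightarrow>\<^bsub>full_graph g k\<^esub> v"
  using wf_digraph.reachable_adj_trans[OF wf_full_graph]
  by (auto simp: H_graph_def adj_induce_subgraph)

lemma Start_in_H_graph: "Start \<in> verts (H_graph g k)"
  unfolding verts_H_graph
  by (rule wf_digraph.reachable_refl[OF wf_full_graph]) (simp add: verts_full_graph)

lemma H_graph_reachable:
  assumes "v \<in> verts (H_graph g k)"
  shows "Start \<rightarrow>\<^sup>*\<^bsub>H_graph g k\<^esub> v"
  using assms unfolding verts_H_graph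
proof (induction rule: wf_digraph.reachable_induct[OF wf_full_graph, consumes 1, case_names base step])
  case base
  show ?case by (rule wf_digraph.reachable_refl[OF wf_H_graph Start_in_H_graph])
next
  case (step x y)
  then have "x \<rightarrow>\<^bsub>H_graph g k\<^esub> y" by (simp add: adj_H_graph verts_H_graph)
  with step show ?case using wf_digraph.reachable_adj_trans[OF wf_H_graph] by blast
qed

text \<open>A pivot reaches itself by the empty walk, which merges the two reasons for surviving
  deletion into one.\<close>

lemma verts_Young_graph:
  "v \<in> verts (Young_graph g k) \<longleftrightarrow>
     v \<in> verts (H_graph g k) \<and> (\<exists>w. pivot (H_graph g k) w \<and> v \<rightarrow>\<^sup>*\<^bsub>H_graph g k\<^esub> w)"
  using wf_digraph.reachable_refl[OF wf_H_graph] by (auto simp: Young_graph_def)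

lemma adj_Young_graph:
  "u \<rightarrow>\<^bsub>Young_graph g k\<^esub> v \<longleftrightarrow> u \<in> verts (Young_graph g k) \<and> v \<in> verts (Young_graph g k)
     \<and> u \<rightarrow>\<^bsub>full_graph g k\<^esub> v"
  unfolding Young_graph_def
  by (auto simp: adj_induce_subgraph adj_H_graph)

text \<open>Prepending the edge to a walk from \<open>v\<close> to a pivot shows that
  \<open>u\<close> survives deletion as well.\<close>

lemma Young_graph_predecessor:
  assumes "u \<in> verts (H_graph g k)" "u \<rightarrow>\<^bsub>full_graph g k\<^esub> v" "v \<in> verts (Young_graph g k)"
  shows "u \<rightarrow>\<^bsub>Young_graph g k\<^esub> v"
  using assms wf_digraph.adj_reachable_trans[OF wf_H_graph]
  unfolding adj_Young_graph verts_Young_graph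
  by (meson adj_H_graph)

lemma no_adj_Start: "\<not> u \<rightarrow>\<^bsub>Young_graph g k\<^esub> Start"
  by (auto simp: adj_Young_graph adj_full_graph young_arc_def)

text \<open>The last edge of a walk from \<open>Start\<close> to \<open>v\<close> also lies in the
  Young graph.\<close>

lemma Young_graph_has_predecessor:
  assumes "v \<in> verts (Young_graph g k)" "v \<noteq> Start"
  obtains u where "u \<rightarrow>\<^bsub>Young_graph g k\<^esub> v"
proof -
  have "Start \<rightarrow>\<^sup>*\<^bsub>full_graph g k\<^esub> v" using assms by (simp add: verts_Young_graph verts_H_graph)
  then obtain u where "Start \<rightarrow>\<^sup>*\<^bsub>full_graph g k\<^esub> u" "u \<rightarrow>\<^bsub>full_graph g k\<^esub> v"
    using assms(2)
    by (auto simp: reachable_def elim: rtrancl_on.cases)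
  then show thesis using Young_graph_predecessor assms(1) that verts_H_graph by blast
qed

section \<open>Mirror symmetry and nondegenerate graphs\<close>

fun mirror :: "node \<Rightarrow> node" where
  "mirror Start = Node 0 0"
| "mirror (Node R r) = Node r R"

text \<open>Reversing an edge and swapping all pairs interchanges the two defining equations. No
  edge enters \<open>Start\<close>, so \<open>Node 0 0\<close>, which has the same
  \<open>label\<close>, stands in for its mirror.\<close>

lemma mirror_adj:
  assumes "u \<rightarrow>\<^bsub>full_graph g k\<^esub> v"
  shows "mirror v \<rightarrow>\<^bsub>full_graph g k\<^esub> mirror u"
proof -
  obtain A a where "young_arc g k (u, (A, a), v)" "u \<in> verts (full_graph g k)"
    using assms by (auto simp: adj_full_graph)
  then have "young_arc g k (mirror v, (a, A), mirror u)"
    "mirror v \<in> verts (full_graph g k)"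
    by (cases u; auto simp: young_arc_def verts_full_graph)+
  then show ?thesis by (auto simp: adj_full_graph)
qed

lemma mirror_reachable:
  assumes "1 \<le> k" "u \<rightarrow>\<^sup>*\<^bsub>full_graph g k\<^esub> v"
  shows "mirror v \<rightarrow>\<^sup>*\<^bsub>full_graph g k\<^esub> mirror u"
  using assms(2)
proof (induction rule: wf_digraph.reachable_induct[OF wf_full_graph, consumes 1, case_names base step])
  case base
  have "mirror u \<in> verts (full_graph g k)"
    using base assms(1) by (cases u) (auto simp: verts_full_graph)
  then show ?case by (rule wf_digraph.reachable_refl[OF wf_full_graph])
next
  case (step x y)
  then show ?case
    using wf_digraph.adj_reachable_trans[OF wf_full_graph] mirror_adj by blast
qed

text \<open>A walk from the starting node to a pivot is continued to \<open>[0,0]\<close> by its own mirror image.\<close>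

lemma zero_in_H_graph:
  assumes "1 \<le> k" "pivot (H_graph g k) v"
  shows "Node 0 0 \<in> verts (H_graph g k)"
proof -
  have v: "Start \<rightarrow>\<^sup>*\<^bsub>full_graph g k\<^esub> v"
    using assms(2) by (auto simp: pivot_def even_pivot_def odd_pivot_def verts_H_graph)
  \<comment> \<open>An even pivot is its own mirror, and an odd pivot has an edge to its
    mirror.\<close>
  have "v \<rightarrow>\<^sup>*\<^bsub>full_graph g k\<^esub> mirror v"
    using assms(2) unfolding pivot_def
  proof
    assume "even_pivot (H_graph g k) v"
    then have "mirror v = v" by (auto simp: even_pivot_def)
    then show ?thesis
      using wf_digraph.reachable_refl[OF wf_full_graph] wf_digraph.reachable_in_verts[OF wf_full_graph v]
      by simp
  next
    assume "odd_pivot (H_graph g k) v"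
    then show ?thesis
      using wf_digraph.reachable_adjI[OF wf_full_graph] by (auto simp: odd_pivot_def adj_H_graph)
  qed
  moreover have "mirror v \<rightarrow>\<^sup>*\<^bsub>full_graph g k\<^esub> Node 0 0"
    using mirror_reachable[OF assms(1) v] by simp
  ultimately show ?thesis
    using v wf_digraph.reachable_trans[OF wf_full_graph] unfolding verts_H_graph by blast
qed

text \<open>Once \<open>Node 0 0\<close> is reachable, it is itself an even pivot; hence it survives
  deletion, and so does \<open>Start\<close>, which reaches it.\<close>

lemma nondegenerate_nodes:
  assumes "1 \<le> k" "nondegenerate g k"
  shows "even_pivot (H_graph g k) (Node 0 0)"
    and "Node 0 0 \<in> verts (Young_graph g k)" and "Start \<in> verts (Young_graph g k)"
proof -
  obtain v where "pivot (H_graph g k) v" using assms(2) by (auto simp: nondegenerate_def)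
  then have H: "Node 0 0 \<in> verts (H_graph g k)" by (rule zero_in_H_graph[OF assms(1)])
  then show ev: "even_pivot (H_graph g k) (Node 0 0)" by (simp add: even_pivot_def)
  then have "pivot (H_graph g k) (Node 0 0)" by (simp add: pivot_def)
  then show "Node 0 0 \<in> verts (Young_graph g k)" "Start \<in> verts (Young_graph g k)"
    using H H_graph_reachable Start_in_H_graph wf_digraph.reachable_refl[OF wf_H_graph H]
    by (auto simp: verts_Young_graph)
qed

text \<open>The first edge of a walk from \<open>Start\<close> to the pivot \<open>Node 0 0\<close>
  is kept, since its head still reaches that pivot.\<close>

lemma Start_has_successor:
  assumes "1 \<le> k" "nondegenerate g k"
  obtains s where "Start \<rightarrow>\<^bsub>Young_graph g k\<^esub> s"
proof -
  have "Start \<rightarrow>\<^sup>*\<^bsub>H_graph g k\<^esub> Node 0 0"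
    using nondegenerate_nodes(1)[OF assms] by (simp add: H_graph_reachable even_pivot_def)
  then obtain s where s: "Start \<rightarrow>\<^bsub>H_graph g k\<^esub> s" "s \<rightarrow>\<^sup>*\<^bsub>H_graph g k\<^esub> Node 0 0"
    by (cases rule: pre_digraph.converse_reachable_cases) auto
  have "s \<in> verts (H_graph g k)"
    using s(1) wf_digraph.adj_in_verts[OF wf_H_graph] by blast
  then have "s \<in> verts (Young_graph g k)"
    using s nondegenerate_nodes(1)[OF assms] by (auto simp: verts_Young_graph pivot_def)
  then have "Start \<rightarrow>\<^bsub>Young_graph g k\<^esub> s"
    using s(1) Young_graph_predecessor Start_in_H_graph by (simp add: adj_H_graph)
  then show thesis by (rule that)
qed

section \<open>Arithmetic of edges at \<open>Start\<close> and at diagonal nodes\<close>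

text \<open>The edge equations would give \<open>a = k * k * a\<close>, which is impossible for
  nonzero \<open>a\<close>.\<close>

lemma not_adj_Start_zero:
  assumes "2 \<le> k"
  shows "\<not> Start \<rightarrow>\<^bsub>full_graph g k\<^esub> Node 0 0"
proof
  assume "Start \<rightarrow>\<^bsub>full_graph g k\<^esub> Node 0 0"
  then obtain l where l: "young_arc g k (Start, l, Node 0 0)" by (auto simp: adj_full_graph)
  obtain A a where [simp]: "l = (A, a)" by (cases l)
  have "k * a = A" "k * A = a" "0 < a" using l by (auto simp: young_arc_def)
  then have "(k * k) * a = 1 * a" by (simp add: mult.assoc)
  with \<open>0 < a\<close> have "k * k = 1" by simp
  moreover have "k * k > 1" using assms by (simp add: less_1_mult)
  ultimately show False by simp
qed

text \<open>The same edge label works, as both tails have \<open>label\<close> \<open>(0, 0)\<close>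
  and \<open>Start\<close> only adds a restriction.\<close>

lemma zero_adj_if_Start_adj:
  assumes "1 \<le> k" "Start \<rightarrow>\<^bsub>full_graph g k\<^esub> v"
  shows "Node 0 0 \<rightarrow>\<^bsub>full_graph g k\<^esub> v"
  using assms by (auto simp: adj_full_graph young_arc_def verts_full_graph)

lemma zero_loop:
  assumes "1 \<le> k" "1 \<le> g"
  shows "Node 0 0 \<rightarrow>\<^bsub>full_graph g k\<^esub> Node 0 0"
  using assms by (auto simp: adj_full_graph young_arc_def verts_full_graph intro!: exI[of _ 0])

lemma Start_adj_diagonal:
  assumes k: "2 \<le> k" "k < g" and "0 < c"
    and S: "Start \<rightarrow>\<^bsub>full_graph g k\<^esub> s" and cs: "Node c c \<rightarrow>\<^bsub>full_graph g k\<^esub> s"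
    and loop: "Node c c \<rightarrow>\<^bsub>full_graph g k\<^esub> Node c c"
  shows "Start \<rightarrow>\<^bsub>full_graph g k\<^esub> Node c c"
proof -
  obtain A a where Aa: "young_arc g k (Start, (A, a), s)" using S by (auto simp: adj_full_graph)
  obtain B b where Bb: "young_arc g k (Node c c, (B, b), s)" using cs by (auto simp: adj_full_graph)
  obtain X x where Xx: "young_arc g k (Node c c, (X, x), Node c c)"
    using loop by (auto simp: adj_full_graph)
  define D d where "D = B - A" and "d = b - a"
  \<comment> \<open>The coordinates of the common head \<open>s\<close> cancel in the
    differences.\<close>
  have D: "k * d + c = D" and d: "k * D = d + c * g"
    using Aa Bb by (auto simp: young_arc_def D_def d_def algebra_simps)
  have kd: "(k * k - 1) * d = c * (g - k)"
    using D d by (simp add: algebra_simps flip: D)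
  have k1: "k * k > 1" using k(1) by (simp add: less_1_mult)
  have "0 < (k * k - 1) * d" unfolding kd using k \<open>0 < c\<close> by simp
  then have d0: "0 < d" using k1 by (simp add: zero_less_mult_iff)
  then have D0: "0 < D" using D k \<open>0 < c\<close> by (simp flip: D add: add_pos_pos)
  have X: "k * x + c = X + c * g" "k * X + c = x + c * g" "X \<le> g - 1" "x \<le> g - 1"
    "c \<le> k - 1"
    using Xx by (auto simp: young_arc_def)
  \<comment> \<open>The difference of the two loop equations forces both entries of the loop label
    to agree.\<close>
  have "(k + 1) * (X - x) = 0" using X(1,2) by (simp add: algebra_simps)
  then have "X = x" using k(1) by simp
  then have kx: "(k - 1) * x = c * (g - 1)" using X(1) by (simp add: algebra_simps)
  text \<open>Subtracting the label difference \<open>(D, d)\<close> from the loop label \<open>(x, x)\<close> yields \<open>(d, D)\<close>.\<close>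
  have "(k - 1) * (d + D) = (k * k - 1) * d + c * (k - 1)"
    by (simp flip: D add: algebra_simps)
  also have "\<dots> = (k - 1) * x" unfolding kd kx by (simp add: algebra_simps)
  finally have x: "d + D = x" using k(1) by simp
  \<comment> \<open>The equations needed are exactly \<open>D\<close> and \<open>d\<close>.
    Positivity of both entries meets the condition at \<open>Start\<close> and, as their sum is
    \<open>x \<le> g - 1\<close>, also bounds each of them.\<close>
  have "young_arc g k (Start, (d, D), Node c c)"
    using D d d0 D0 X x \<open>0 < c\<close> by (auto simp: young_arc_def algebra_simps)
  then show ?thesis by (auto simp: adj_full_graph verts_full_graph)
qed

theorem theorem3:
  fixes g k g' k' :: int and \<phi> :: "node \<Rightarrow> node"
  assumes "2 \<le> k" "k < g" "2 \<le> k'" "k' < g'"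
    and "nondegenerate g k" "nondegenerate g' k'"
    and "Young_isomorphism g k g' k' \<phi>"
  shows "\<phi> Start = Start \<and> \<phi> (Node 0 0) = Node 0 0"
proof -
  let ?Y = "Young_graph g k" and ?Y' = "Young_graph g' k'"
  have k1: "1 \<le> k" "1 \<le> k'" "1 \<le> g" using assms(1-4) by simp_all
  have im: "\<phi> ` verts ?Y = verts ?Y'"
    and adj: "\<And>u v. u \<in> verts ?Y \<Longrightarrow> v \<in> verts ?Y \<Longrightarrow> u \<rightarrow>\<^bsub>?Y\<^esub> v \<longleftrightarrow> \<phi> u \<rightarrow>\<^bsub>?Y'\<^esub> \<phi> v"
    using assms(7) digraph_isomorphism_iff_adjacency[OF assms(1,3)]
    unfolding Young_isomorphism_def bij_betw_def by blast+
  note zero = nondegenerate_nodes[OF k1(1) assms(5)]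
  have Start: "\<phi> Start = Start"
  proof (rule ccontr)
    assume neq: "\<phi> Start \<noteq> Start"
    have "\<phi> Start \<in> verts ?Y'" using zero(3) im by blast
    then obtain u' where u': "u' \<rightarrow>\<^bsub>?Y'\<^esub> \<phi> Start" using neq Young_graph_has_predecessor by blast
    then have "u' \<in> verts ?Y'" by (simp add: adj_Young_graph)
    then obtain u where "u \<in> verts ?Y" "u' = \<phi> u" using im by blast
    then show False using u' adj zero(3) no_adj_Start by blast
  qed
  have "even_pivot (H_graph g' k') (\<phi> (Node 0 0))"
    using assms(7) zero(1,2) by (auto simp: Young_isomorphism_def)
  then obtain c where c: "\<phi> (Node 0 0) = Node c c" by (auto simp: even_pivot_def)
  have "c = 0"
  proof (rule ccontr)
    assume "c \<noteq> 0"
    obtain s where s: "Start \<rightarrow>\<^bsub>?Y\<^esub> s" using Start_has_successor[OF k1(1) assms(5)] .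
    then have sV: "s \<in> verts ?Y" by (simp add: adj_Young_graph)
    have "Node 0 0 \<rightarrow>\<^bsub>?Y\<^esub> s" "Node 0 0 \<rightarrow>\<^bsub>?Y\<^esub> Node 0 0"
      using s zero(2) zero_adj_if_Start_adj[OF k1(1)] zero_loop[OF k1(1,3)]
      by (auto simp: adj_Young_graph)
    then have Y': "Start \<rightarrow>\<^bsub>?Y'\<^esub> \<phi> s" "Node c c \<rightarrow>\<^bsub>?Y'\<^esub> \<phi> s" "Node c c \<rightarrow>\<^bsub>?Y'\<^esub> Node c c"
      using s sV zero adj Start c by metis+
    then have full: "Start \<rightarrow>\<^bsub>full_graph g' k'\<^esub> \<phi> s" "Node c c \<rightarrow>\<^bsub>full_graph g' k'\<^esub> \<phi> s"
      "Node c c \<rightarrow>\<^bsub>full_graph g' k'\<^esub> Node c c"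
      by (auto simp: adj_Young_graph)
    then have "0 < c" using \<open>c \<noteq> 0\<close> by (auto simp: adj_full_graph young_arc_def)
    then have "Start \<rightarrow>\<^bsub>full_graph g' k'\<^esub> Node c c"
      using Start_adj_diagonal[OF assms(3,4) _ full] by blast
    then have "Start \<rightarrow>\<^bsub>?Y'\<^esub> Node c c" using Y' by (simp add: adj_Young_graph)
    \<comment> \<open>The isomorphism reflects adjacency, so the edge pulls back to the impossible
      one.\<close>
    then have "Start \<rightarrow>\<^bsub>?Y\<^esub> Node 0 0" using adj zero Start c by metis
    then show False using not_adj_Start_zero[OF assms(1)] by (simp add: adj_Young_graph)
  qed
  with Start c show ?thesis by simp
qed

end
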